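(* Let $D\ge 3$. For the folded cube $\square_{2D}$, the Terwilliger algebra $T$ with respect to $\mathbf 0$ coincides with the linear span $\mathcal A$ of the matrices $M^t_{i,j}$, $(i,j,t)\in\mathcal I$; moreover these matrices form a basis of $\mathcal A$.
   Context: Let $S=\{1,\dots,2D\}$, $X$ the set of unordered pairs $\{u,u'\}$ of subsets of $S$ with $u\cap u'=\emptyset$, $u\cup u'=S$. The folded cube $\square_{2D}$ is the graph on $X$ with distance $\partial(x,y)=\min\{|x_1\triangle y_1|,|x_1\triangle y_2|\}$ for $x=\{x_1,x_2\},y=\{y_1,y_2\}$ (adjacent iff distance $1$); its diameter is $D$. Let $\mathbf 0=\{\emptyset,S\}$. Write each vertex as $x=(x_1,x_2)$ with parts labeled so that $|x_1|\le|x_2|$ (arbitrarily if $|x_1|=|x_2|=D$). For $x,y\in X$ put $\partial(\mathbf 0,x,y)=(i,j,t)$ where $i=|x_1|$, $j=|y_1|$ and $t=|x_1\cap y_1|$ if $i,j\le D-1$; $t=\max\{|x_1\cap y_1|,|x_2\cap y_1|\}$ if $i=D$, $j\le D-1$; $t=\max\{|x_1\cap y_1|,|x_1\cap y_2|\}$ if $i\le D-1$, $j=D$ or if $i=j=D$. Let $\mathcal I=\{(i,j,t): 0\le t\le i,j\le D,\ i+j-t\le 2D-2,\ t\ge\lfloor (j+1)/2\rfloor \text{ if } i=D,\ t\ge\lfloor (i+1)/2\rfloor\text{ if } j=D\}$. For $(i,j,t)\in\mathcal I$, $M^t_{i,j}$ is the $X\times X$ matrix with $(x,y)$-entry $1$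 if $\partial(\mathbf 0,x,y)=(i,j,t)$ and $0$ otherwise. For $0\le k\le D$, $A_k$ is the distance-$k$ matrix of $\square_{2D}$ and $E^*_k$ the diagonal matrix with $(y,y)$-entry $1$ iff $\partial(\mathbf 0,y)=k$. The Terwilliger algebra $T$ with respect to $\mathbf 0$ is the subalgebra of $\mathrm{Mat}_X(\mathbb C)$ generated by $A_0,\dots,A_D,E^*_0,\dots,E^*_D$. *)

theory Defs
  imports Complex_Main "HOL-Library.Function_Algebras"
begin

type_synonym vertex = "nat set set"
type_synonym vmat = "vertex \<Rightarrow> vertex \<Rightarrow> complex"

section \<open>The folded cube\<close>

definition ground :: "nat \<Rightarrow> nat set" where
  "ground D = {1..2 * D}"

definition verts :: "nat \<Rightarrow> vertex set" where
  "verts D = {{u, u'} | u u'. u \<inter> u' = {} \<and> u \<union> u' = ground D}"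

definition base :: "nat \<Rightarrow> vertex" where
  "base D = {{}, ground D}"

text \<open>The value does not depend on how the parts of the two vertices are named;
  see \<open>fdist_eq\<close> below.\<close>

definition fdist :: "vertex \<Rightarrow> vertex \<Rightarrow> nat" where
  "fdist x y = (THE d. \<exists>x1 x2 y1 y2. x = {x1, x2} \<and> y = {y1, y2} \<and>
     d = min (card (sym_diff x1 y1)) (card (sym_diff x1 y2)))"

lemma verts_parts:
  assumes "{u, u'} \<in> verts D"
  shows "u \<subseteq> ground D" "u' = ground D - u"
  using assms unfolding verts_def by (auto simp: doubleton_eq_iff)

lemma fdist_eq:
  assumes "{x1, x2} \<in> verts D" "{y1, y2} \<in> verts D"
  shows "fdist {x1, x2} {y1, y2} = min (card (sym_diff x1 y1)) (card (sym_diff x1 y2))"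
proof -
  note x = verts_parts[OF assms(1)] and y = verts_parts[OF assms(2)]
  have 1: "sym_diff x2 y2 = sym_diff x1 y1" "sym_diff x2 y1 = sym_diff x1 y2"
    using x y by auto
  show ?thesis
    unfolding fdist_def
  proof (rule the_equality)
    show "\<exists>a b c d. {x1, x2} = {a, b} \<and> {y1, y2} = {c, d} \<and>
      min (card (sym_diff x1 y1)) (card (sym_diff x1 y2)) =
      min (card (sym_diff a c)) (card (sym_diff a d))"
      by blast
  next
    fix e
    assume "\<exists>a b c d. {x1, x2} = {a, b} \<and> {y1, y2} = {c, d} \<and>
      e = min (card (sym_diff a c)) (card (sym_diff a d))"
    then obtain a b c d where *: "{x1, x2} = {a, b}" "{y1, y2} = {c, d}"
      "e = min (card (sym_diff a c)) (card (sym_diff a d))" by blast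
    show "e = min (card (sym_diff x1 y1)) (card (sym_diff x1 y2))"
    proof -
      have "a = x1 \<and> b = x2 \<or> a = x2 \<and> b = x1" "c = y1 \<and> d = y2 \<or> c = y2 \<and> d = y1"
        using *(1,2) unfolding doubleton_eq_iff by auto
      then show ?thesis
        unfolding *(3) by (elim disjE conjE; hypsubst) (simp_all only: 1 min.commute)
    qed
  qed
qed

text \<open>A labelling writes every vertex as an ordered pair whose first part is not the
  larger one; for two parts of equal size the order is arbitrary.\<close>

definition labelling :: "nat \<Rightarrow> (vertex \<Rightarrow> nat set \<times> nat set) \<Rightarrow> bool" where
  "labelling D l \<longleftrightarrow>
     (\<forall>x\<in>verts D. x = {fst (l x), snd (l x)} \<and> card (fst (l x)) \<le> card (snd (l x)))"

definition triple ::
    "nat \<Rightarrow> (vertex \<Rightarrow> nat set \<times> nat set) \<Rightarrow> vertex \<Rightarrow> vertex \<Rightarrow> nat \<times> nat \<times> nat" where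
  "triple D l x y =
     (let (x1, x2) = l x; (y1, y2) = l y; i = card x1; j = card y1 in
      (i, j,
       if i < D \<and> j < D then card (x1 \<inter> y1)
       else if i = D \<and> j < D then max (card (x1 \<inter> y1)) (card (x2 \<inter> y1))
       else max (card (x1 \<inter> y1)) (card (x1 \<inter> y2))))"

definition index_set :: "nat \<Rightarrow> (nat \<times> nat \<times> nat) set" where
  "index_set D = {(i, j, t). t \<le> i \<and> t \<le> j \<and> i \<le> D \<and> j \<le> D \<and>
     i + j - t \<le> 2 * D - 2 \<and>
     (i = D \<longrightarrow> t \<ge> (j + 1) div 2) \<and> (j = D \<longrightarrow> t \<ge> (i + 1) div 2)}"

section \<open>Matrices indexed by the vertices\<close>

text \<open>A matrix with rows and columns indexed by \<open>verts D\<close> is represented by a function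
  that vanishes outside \<open>verts D \<times> verts D\<close>; addition is pointwise.\<close>

definition vmats :: "nat \<Rightarrow> vmat set" where
  "vmats D = {A. \<forall>x y. x \<notin> verts D \<or> y \<notin> verts D \<longrightarrow> A x y = 0}"

definition vmat_scale :: "complex \<Rightarrow> vmat \<Rightarrow> vmat" where
  "vmat_scale c A = (\<lambda>x y. c * A x y)"

definition vmat_mult :: "nat \<Rightarrow> vmat \<Rightarrow> vmat \<Rightarrow> vmat" where
  "vmat_mult D A B = (\<lambda>x y. \<Sum>z\<in>verts D. A x z * B z y)"

definition vmat_one :: "nat \<Rightarrow> vmat" where
  "vmat_one D = (\<lambda>x y. if x \<in> verts D \<and> x = y then 1 else 0)"

global_interpretation vmat: vector_space vmat_scale
  by unfold_locales (auto simp: vmat_scale_def fun_eq_iff algebra_simps)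

definition subalgebra :: "nat \<Rightarrow> vmat set \<Rightarrow> bool" where
  "subalgebra D B \<longleftrightarrow> B \<subseteq> vmats D \<and> vmat.subspace B \<and> vmat_one D \<in> B \<and>
     (\<forall>P\<in>B. \<forall>Q\<in>B. vmat_mult D P Q \<in> B)"

definition dist_mat :: "nat \<Rightarrow> nat \<Rightarrow> vmat" where
  "dist_mat D k = (\<lambda>x y. if x \<in> verts D \<and> y \<in> verts D \<and> fdist x y = k then 1 else 0)"

definition dual_idem :: "nat \<Rightarrow> nat \<Rightarrow> vmat" where
  "dual_idem D k = (\<lambda>x y. if x \<in> verts D \<and> x = y \<and> fdist (base D) y = k then 1 else 0)"

definition terwilliger :: "nat \<Rightarrow> vmat set" where
  "terwilliger D = subalgebra D hull (dist_mat D ` {0..D} \<union> dual_idem D ` {0..D})"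

definition M_mat :: "nat \<Rightarrow> (vertex \<Rightarrow> nat set \<times> nat set) \<Rightarrow> nat \<times> nat \<times> nat \<Rightarrow> vmat" where
  "M_mat D l ijt =
     (\<lambda>x y. if x \<in> verts D \<and> y \<in> verts D \<and> triple D l x y = ijt then 1 else 0)"

definition M_span :: "nat \<Rightarrow> (vertex \<Rightarrow> nat set \<times> nat set) \<Rightarrow> vmat set" where
  "M_span D l = vmat.span (M_mat D l ` index_set D)"

end

theory Submission
  imports Defs
begin

text \<open>The triples are the orbits on pairs of vertices of the symmetric group on the ground set,
  which fixes the base vertex. Hence the span of the \<open>M\<close>-matrices is the algebra of matrices
  invariant under this group, and it contains the Terwilliger algebra. Conversely, cutting the
  adjacency matrix by the dual idempotents yields \<open>M\<close> at \<open>(i, i + 1, i)\<close> and \<open>(i + 1, i, i)\<close>;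
  products of these give the containment matrices (\<open>t = min i j\<close>) and the adjacency matrices
  of the Johnson graphs, folded at level \<open>D\<close>, on the levels (\<open>(j, j, j - 1)\<close>). Multiplying
  \<open>M\<close> at \<open>(i, j, t + 1)\<close> by the latter produces \<open>M\<close> at \<open>(i, j, t)\<close> up to terms of larger
  third index, so a downward induction on \<open>t\<close> reaches every \<open>M\<close>-matrix.\<close>

section \<open>Vertices and triples\<close>

definition vert :: "nat \<Rightarrow> nat set \<Rightarrow> vertex" where
  "vert D u = {u, ground D - u}"

lemma finite_ground [simp]: "finite (ground D)"
  by (simp add: ground_def)

lemma card_ground [simp]: "card (ground D) = 2 * D"
  by (simp add: ground_def)

lemma vert_in_verts: "u \<subseteq> ground D \<Longrightarrow> vert D u \<in> verts D"
  unfolding verts_def vert_def by blast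

lemma card_compl_ground: "u \<subseteq> ground D \<Longrightarrow> card (ground D - u) = 2 * D - card u"
  by (simp add: card_Diff_subset finite_subset)

lemma vert_compl: "u \<subseteq> ground D \<Longrightarrow> vert D (ground D - u) = vert D u"
  unfolding vert_def by (simp add: double_diff insert_commute)

lemma verts_obtain:
  assumes "x \<in> verts D"
  obtains u where "u \<subseteq> ground D" "card u \<le> D" "x = vert D u"
proof -
  obtain u u' where u: "x = {u, u'}" "u \<inter> u' = {}" "u \<union> u' = ground D"
    using assms unfolding verts_def by blast
  then have "u \<subseteq> ground D" "u' = ground D - u" "u' \<subseteq> ground D" by auto
  then have x: "x = vert D u" using u by (simp add: vert_def)
  show thesis
  proof (cases "card u \<le> D")
    case True
    then show ?thesis using that x \<open>u \<subseteq> ground D\<close> by blast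
  next
    case False
    then have "card u' \<le> D" using \<open>u \<subseteq> ground D\<close> \<open>u' = ground D - u\<close>
      by (simp add: card_compl_ground)
    then show ?thesis
      using that[of u'] x \<open>u \<subseteq> ground D\<close> \<open>u' = ground D - u\<close> vert_compl by blast
  qed
qed

lemma finite_verts [simp]: "finite (verts D)"
proof (rule finite_subset)
  show "verts D \<subseteq> vert D ` Pow (ground D)"
    by (auto elim: verts_obtain)
qed simp

text \<open>A part with fewer than \<open>D\<close> elements is the unique smaller part of its
  vertex, since its complement has more than \<open>D\<close> elements. At size \<open>D\<close> the
  complement would be a second choice. Products of basis matrices use this for a middle vertex at a
  level below \<open>D\<close>.\<close>

lemma vert_eqD:
  assumes "vert D u = vert D v" "u \<subseteq> ground D" "card u < D" "card v < D"
  shows "u = v"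
proof -
  have "card (ground D - u) > D" using assms by (simp add: card_compl_ground)
  then have "v \<noteq> ground D - u" using assms(4) by auto
  then show ?thesis using assms(1) by (auto simp: vert_def doubleton_eq_iff)
qed

lemma card_Int_compl:
  "u \<subseteq> ground D \<Longrightarrow> card (u \<inter> (ground D - v)) = card u - card (u \<inter> v)"
  by (metis Int_Diff Int_absorb2 card_Diff_subset_Int finite_Int finite_ground finite_subset)

lemma card_Int_eqD:
  assumes "card (u \<inter> v) = card u" "u \<subseteq> ground D"
  shows "u \<subseteq> v"
  using assms card_subset_eq[of u "u \<inter> v"] finite_subset[OF assms(2)] by auto

lemma card_Int_bound:
  "u \<subseteq> ground D \<Longrightarrow> card (u \<inter> v) \<le> card u" "v \<subseteq> ground D \<Longrightarrow> card (u \<inter> v) \<le> card v"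
  by (auto intro!: card_mono intro: finite_subset)

text \<open>The third component of \<open>triple\<close> as a function of \<open>i = card u\<close>,
  \<open>j = card v\<close> and \<open>s = card (u \<inter> v)\<close>. Replacing \<open>u\<close>
  by its complement turns \<open>s\<close> into \<open>j - s\<close>, replacing \<open>v\<close>
  turns it into \<open>i - s\<close>; the maximum makes the value independent of the part chosen at
  level \<open>D\<close>.\<close>

definition third_index :: "nat \<Rightarrow> nat \<Rightarrow> nat \<Rightarrow> nat \<Rightarrow> nat" where
  "third_index D i j s =
     (if i < D \<and> j < D then s else if i = D \<and> j < D then max s (j - s) else max s (i - s))"

text \<open>The maximum of two numbers with sum \<open>j\<close> is at least
  \<open>(j + 1) div 2\<close>, which gives the lower bounds at level \<open>D\<close>. There the
  bound \<open>2 * D - 2\<close> comes down to \<open>D div 2 \<le> D - 2\<close>, and this is where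
  \<open>D \<ge> 3\<close> enters.\<close>

lemma third_index_index_set:
  "D \<ge> 3 \<Longrightarrow> i \<le> D \<Longrightarrow> j \<le> D \<Longrightarrow> s \<le> i \<Longrightarrow> s \<le> j \<Longrightarrow>
    (i, j, third_index D i j s) \<in> index_set D"
  by (auto simp: third_index_def index_set_def max_def)

text \<open>The lower bounds at level \<open>D\<close> say that \<open>t\<close> is already the
  larger of the two candidates, so \<open>third_index\<close> is a retraction onto the admissible
  values.\<close>

lemma third_index_id: "(i, j, t) \<in> index_set D \<Longrightarrow> third_index D i j t = t"
  by (auto simp: third_index_def index_set_def max_def)

lemma third_index_lipschitz:
  "s \<le> s' + 1 \<Longrightarrow> s' \<le> s + 1 \<Longrightarrow> third_index D i j s \<le> third_index D i j s' + 1"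
  by (auto simp: third_index_def max_def)

section \<open>Folded distance in terms of cardinalities\<close>

lemma fdist_vert:
  assumes "u \<subseteq> ground D" "v \<subseteq> ground D"
  shows "fdist (vert D u) (vert D v) =
    min (card u + card v - 2 * card (u \<inter> v)) (2 * D - (card u + card v - 2 * card (u \<inter> v)))"
proof -
  have fin: "finite u" "finite v" using assms by (auto intro: finite_subset)
  have "card (sym_diff u v) = card (u - v) + card (v - u)"
    using fin by (intro card_Un_disjoint) auto
  also have "\<dots> = card u + card v - 2 * card (u \<inter> v)"
    using fin card_Int_bound[OF assms(1), of v] card_Int_bound(2)[OF assms(2), of u]
    by (simp add: card_Diff_subset_Int Int_commute)
  finally have 1: "card (sym_diff u v) = card u + card v - 2 * card (u \<inter> v)" .
  have "sym_diff u (ground D - v) = ground D - sym_diff u v" using assms by auto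
  then have 2: "card (sym_diff u (ground D - v)) = 2 * D - card (sym_diff u v)"
    using assms card_compl_ground[of "sym_diff u v" D] by auto
  show ?thesis
    using fdist_eq[of u "ground D - u" D v "ground D - v"] vert_in_verts assms 1 2
    unfolding vert_def by metis
qed

lemma base_vert: "base D = vert D {}"
  by (simp add: base_def vert_def)

lemma fdist_base_vert: "u \<subseteq> ground D \<Longrightarrow> card u \<le> D \<Longrightarrow> fdist (base D) (vert D u) = card u"
  by (simp add: base_vert fdist_vert)

section \<open>Permutations of the ground set\<close>

abbreviation vact :: "(nat \<Rightarrow> nat) \<Rightarrow> vertex \<Rightarrow> vertex" where
  "vact p x \<equiv> (\<lambda>u. p ` u) ` x"

lemma perm_image:
  assumes "bij_betw p (ground D) (ground D)" "u \<subseteq> ground D"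
  shows "p ` u \<subseteq> ground D" "card (p ` u) = card u"
proof -
  show "p ` u \<subseteq> ground D" using assms by (auto simp: bij_betw_def)
  show "card (p ` u) = card u"
    using assms by (metis bij_betw_def card_image inj_on_subset)
qed

lemma perm_Int:
  assumes "bij_betw p (ground D) (ground D)" "u \<subseteq> ground D" "v \<subseteq> ground D"
  shows "card (p ` u \<inter> p ` v) = card (u \<inter> v)"
proof -
  have "p ` u \<inter> p ` v = p ` (u \<inter> v)"
    using assms inj_on_image_Int[of p "ground D" u v] by (auto simp: bij_betw_def)
  then show ?thesis using perm_image(2)[OF assms(1), of "u \<inter> v"] assms(2) by auto
qed

lemma vact_vert:
  assumes "bij_betw p (ground D) (ground D)" "u \<subseteq> ground D"
  shows "vact p (vert D u) = vert D (p ` u)"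
proof -
  have "p ` (ground D - u) = ground D - p ` u"
    using assms inj_on_image_set_diff[of p "ground D" "ground D" u] by (auto simp: bij_betw_def)
  then show ?thesis by (simp add: vert_def)
qed

lemma bij_betw_vact:
  assumes "bij_betw p (ground D) (ground D)"
  shows "bij_betw (vact p) (verts D) (verts D)"
proof -
  have inj: "inj_on (image p) (Pow (ground D))"
    using assms by (simp add: bij_betw_def inj_on_image_Pow)
  have "inj_on (vact p) (Pow (Pow (ground D)))"
    using inj by (rule inj_on_image_Pow)
  moreover have sub: "verts D \<subseteq> Pow (Pow (ground D))" by (auto simp: verts_def)
  ultimately have "inj_on (vact p) (verts D)" by (rule inj_on_subset)
  moreover have "vact p ` verts D \<subseteq> verts D"
    using vact_vert[OF assms] perm_image(1)[OF assms] vert_in_verts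
    by (auto elim!: verts_obtain)
  ultimately show ?thesis
    by (simp add: bij_betw_def endo_inj_surj)
qed

lemma fdist_vact:
  assumes "bij_betw p (ground D) (ground D)" "x \<in> verts D" "y \<in> verts D"
  shows "fdist (vact p x) (vact p y) = fdist x y"
proof -
  obtain u v where "u \<subseteq> ground D" "x = vert D u" "v \<subseteq> ground D" "y = vert D v"
    using assms(2,3) by (metis verts_obtain)
  then show ?thesis
    using assms(1) by (simp add: vact_vert fdist_vert perm_image perm_Int)
qed

section \<open>Transitivity on pairs of subsets with given sizes\<close>

lemma bij_betw_respecting_subset:
  assumes "finite A" "finite A'" "card A = card A'"
    and "B \<subseteq> A" "B' \<subseteq> A'" "card B = card B'"
  obtains f where "bij_betw f A A'" "f ` B = B'"
proof -
  have fin: "finite B" "finite B'" using assms finite_subset by auto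
  obtain g where g: "bij_betw g B B'"
    using finite_same_card_bij[OF fin assms(6)] by blast
  have "card (A - B) = card (A' - B')"
    using assms fin by (simp add: card_Diff_subset)
  then obtain h where h: "bij_betw h (A - B) (A' - B')"
    using finite_same_card_bij assms(1,2) by blast
  let ?f = "\<lambda>a. if a \<in> B then g a else h a"
  have "bij_betw ?f (B \<union> (A - B)) (B' \<union> (A' - B'))"
    by (rule bij_betw_disjoint_Un[OF g h]) auto
  then have "bij_betw ?f A A'" using assms(4,5) by (simp add: Un_absorb1)
  moreover have "?f ` B = B'" using g by (auto simp: bij_betw_def)
  ultimately show thesis using that by blast
qed

text \<open>The three cardinalities determine the sizes of all four Venn regions of \<open>u\<close>
  and \<open>v\<close>. A bijection on \<open>u\<close> respecting \<open>u \<inter> v\<close> is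
  glued to one on the complement respecting \<open>v - u\<close>.\<close>

lemma perm_exists:
  assumes "u \<subseteq> ground D" "v \<subseteq> ground D" "u' \<subseteq> ground D" "v' \<subseteq> ground D"
    and "card u = card u'" "card v = card v'" "card (u \<inter> v) = card (u' \<inter> v')"
  obtains p where "bij_betw p (ground D) (ground D)" "p ` u = u'" "p ` v = v'"
proof -
  have fin: "finite u" "finite v" "finite u'" "finite v'"
    using assms finite_subset finite_ground by blast+
  obtain f where f: "bij_betw f u u'" "f ` (u \<inter> v) = u' \<inter> v'"
    using bij_betw_respecting_subset[of u u' "u \<inter> v" "u' \<inter> v'"] assms fin by auto
  have "card (v - u) = card (v' - u')"
    using assms fin by (simp add: card_Diff_subset_Int Int_commute)
  moreover have "card (ground D - u) = card (ground D - u')"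
    using assms by (simp add: card_compl_ground)
  ultimately obtain g where g: "bij_betw g (ground D - u) (ground D - u')" "g ` (v - u) = v' - u'"
    using bij_betw_respecting_subset[of "ground D - u" "ground D - u'" "v - u" "v' - u'"] assms
    by (metis Diff_mono finite_Diff finite_ground order_refl)
  let ?p = "\<lambda>a. if a \<in> u then f a else g a"
  have "bij_betw ?p (u \<union> (ground D - u)) (u' \<union> (ground D - u'))"
    by (rule bij_betw_disjoint_Un[OF f(1) g(1)]) auto
  then have "bij_betw ?p (ground D) (ground D)" using assms by (simp add: Un_absorb1)
  moreover have "?p ` u = u'" using f(1) by (auto simp: bij_betw_def)
  moreover have "?p ` v = v'"
  proof -
    have "?p ` v = f ` (u \<inter> v) \<union> g ` (v - u)" by auto
    then show ?thesis using f(2) g(2) by auto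
  qed
  ultimately show thesis using that by blast
qed

section \<open>The algebra of invariant matrices\<close>

text \<open>The centralizer algebra of the symmetric group of the ground set in its permutation
  representation on the vertices. The values of \<open>p\<close> outside the ground set are
  immaterial, as vertices consist of subsets of it.\<close>

definition invariant_mats :: "nat \<Rightarrow> vmat set" where
  "invariant_mats D = {A \<in> vmats D. \<forall>p. bij_betw p (ground D) (ground D) \<longrightarrow>
     (\<forall>x\<in>verts D. \<forall>y\<in>verts D. A (vact p x) (vact p y) = A x y)}"

lemma vact_eq_iff:
  assumes "bij_betw p (ground D) (ground D)" "x \<in> verts D" "y \<in> verts D"
  shows "vact p x = vact p y \<longleftrightarrow> x = y"
  using bij_betw_vact[OF assms(1)] assms(2,3) by (auto simp: bij_betw_def inj_on_def)

lemma vact_in_verts: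
  assumes "bij_betw p (ground D) (ground D)" "x \<in> verts D"
  shows "vact p x \<in> verts D"
  using bij_betw_vact[OF assms(1)] assms(2) by (rule bij_betwE[rule_format])

lemma vmat_mult_in_vmats: "A \<in> vmats D \<Longrightarrow> B \<in> vmats D \<Longrightarrow> vmat_mult D A B \<in> vmats D"
  by (auto simp: vmats_def vmat_mult_def)

lemma invariant_mats_mult:
  assumes "A \<in> invariant_mats D" "B \<in> invariant_mats D"
  shows "vmat_mult D A B \<in> invariant_mats D"
proof -
  have "vmat_mult D A B (vact p x) (vact p y) = vmat_mult D A B x y"
    if p: "bij_betw p (ground D) (ground D)" and xy: "x \<in> verts D" "y \<in> verts D" for p x y
  proof -
    \<comment> \<open>The group element permutes the vertices, so the summation variable may be
      replaced by its image; invariance then applies to both factors of each term.\<close>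
    have "vmat_mult D A B (vact p x) (vact p y) =
        (\<Sum>z\<in>verts D. A (vact p x) (vact p z) * B (vact p z) (vact p y))"
      unfolding vmat_mult_def
      by (rule sum.reindex_bij_betw[OF bij_betw_vact[OF p], symmetric])
    also have "\<dots> = vmat_mult D A B x y"
      unfolding vmat_mult_def
      using assms p xy by (intro sum.cong) (auto simp: invariant_mats_def)
    finally show ?thesis .
  qed
  then show ?thesis
    using assms by (auto simp: invariant_mats_def intro: vmat_mult_in_vmats)
qed

lemma subspace_invariant_mats: "vmat.subspace (invariant_mats D)"
  by (rule vmat.subspaceI) (auto simp: invariant_mats_def vmats_def vmat_scale_def)

lemma subalgebra_invariant_mats: "subalgebra D (invariant_mats D)"
proof -
  have "vmat_one D \<in> invariant_mats D"
    by (auto simp: invariant_mats_def vmats_def vmat_one_def vact_eq_iff vact_in_verts)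
  then show ?thesis
    using subspace_invariant_mats invariant_mats_mult
    by (auto simp: subalgebra_def invariant_mats_def)
qed

lemma dist_mat_invariant: "dist_mat D k \<in> invariant_mats D"
  by (auto simp: invariant_mats_def vmats_def dist_mat_def vact_in_verts fdist_vact)

lemma dual_idem_invariant: "dual_idem D k \<in> invariant_mats D"
proof -
  have "fdist (base D) (vact p y) = fdist (base D) y"
    if p: "bij_betw p (ground D) (ground D)" and y: "y \<in> verts D" for p y
    \<comment> \<open>The base vertex is fixed because the image of the empty part is empty.\<close>
    using fdist_vact[OF p _ y, of "base D"] vact_vert[OF p, of "{}"] vert_in_verts[of "{}" D]
    by (simp add: base_vert)
  then show ?thesis
    by (auto simp: invariant_mats_def vmats_def dual_idem_def vact_in_verts vact_eq_iff)
qed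

lemma terwilliger_subset_invariant: "terwilliger D \<subseteq> invariant_mats D"
  unfolding terwilliger_def
  by (rule hull_minimal)
    (auto simp: subalgebra_invariant_mats dist_mat_invariant dual_idem_invariant)

section \<open>Closure properties of the Terwilliger algebra\<close>

lemma terwilliger_generators:
  "k \<le> D \<Longrightarrow> dist_mat D k \<in> terwilliger D" "k \<le> D \<Longrightarrow> dual_idem D k \<in> terwilliger D"
  unfolding terwilliger_def by (auto intro: hull_inc)

lemma terwilliger_mult:
  "A \<in> terwilliger D \<Longrightarrow> B \<in> terwilliger D \<Longrightarrow> vmat_mult D A B \<in> terwilliger D"
  unfolding terwilliger_def hull_def subalgebra_def by blast

lemma subspace_terwilliger: "vmat.subspace (terwilliger D)"
  unfolding terwilliger_def hull_def
  by (rule vmat.subspace_Inter) (auto simp: subalgebra_def)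

section \<open>The matrices of the basis\<close>

locale folded_cube =
  fixes D :: nat and l :: "vertex \<Rightarrow> nat set \<times> nat set"
  assumes D_ge_3: "D \<ge> 3" and labelling: "labelling D l"
begin

text \<open>This removes the arbitrary labelling from all later arguments: a labelling can deviate
  from \<open>(w, ground D - w)\<close> only by a swap at size \<open>D\<close>, and the maximum in
  \<open>third_index\<close> absorbs each swap.\<close>

lemma triple_vert:
  assumes u: "u \<subseteq> ground D" "card u \<le> D" and v: "v \<subseteq> ground D" "card v \<le> D"
  shows "triple D l (vert D u) (vert D v) =
    (card u, card v, third_index D (card u) (card v) (card (u \<inter> v)))"
proof -
  have lab: "l (vert D w) = (w, ground D - w) \<or>
      l (vert D w) = (ground D - w, w) \<and> card w = D \<and> card (ground D - w) = D"
    if w: "w \<subseteq> ground D" "card w \<le> D" for w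
  proof -
    obtain a b where ab: "l (vert D w) = (a, b)" by fastforce
    then have "vert D w = {a, b}" "card a \<le> card b"
      using labelling vert_in_verts[OF w(1)] by (force simp: labelling_def)+
    then have "a = w \<and> b = ground D - w \<or> a = ground D - w \<and> b = w"
      by (auto simp: vert_def doubleton_eq_iff)
    then show ?thesis
      using ab \<open>card a \<le> card b\<close> w card_compl_ground[OF w(1)] by auto
  qed
  have 1: "card (u \<inter> (ground D - v)) = card u - card (u \<inter> v)"
      "card ((ground D - u) \<inter> v) = card v - card (u \<inter> v)"
    using card_Int_compl u(1) v(1) by (metis Int_commute)+
  \<comment> \<open>If both vertices lie at level \<open>D\<close> and both are swapped, this is
    \<open>D - (D - s) = s\<close> with \<open>s = card (u \<inter> v)\<close>, so the two
    candidates are the same as without swaps.\<close>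
  have 2: "card ((ground D - u) \<inter> (ground D - v)) = card (ground D - u) - (card v - card (u \<inter> v))"
    using card_Int_compl[of "ground D - u" D v] 1 by auto
  have 3: "card (u \<inter> v) \<le> card u" "card (u \<inter> v) \<le> card v"
    using card_Int_bound u v by auto
  have 4: "triple D l (vert D u) (vert D v) =
      (card u', card v',
       if card u' < D \<and> card v' < D then card (u' \<inter> v')
       else if card u' = D \<and> card v' < D then max (card (u' \<inter> v')) (card (u'' \<inter> v'))
       else max (card (u' \<inter> v')) (card (u' \<inter> v'')))"
    if "l (vert D u) = (u', u'')" "l (vert D v) = (v', v'')" for u' u'' v' v''
    using that by (simp add: triple_def Let_def)
  show ?thesis
    using lab[OF u] lab[OF v]
  proof (elim disjE conjE)
    assume "l (vert D u) = (u, ground D - u)" "l (vert D v) = (v, ground D - v)"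
    then show ?thesis by (simp only: 4 1 third_index_def)
  next
    assume "l (vert D u) = (u, ground D - u)" "l (vert D v) = (ground D - v, v)"
      "card v = D" "card (ground D - v) = D"
    then show ?thesis using 1 3 u(2) by (simp add: 4 third_index_def max.commute)
  next
    assume "l (vert D u) = (ground D - u, u)" "l (vert D v) = (v, ground D - v)"
      "card u = D" "card (ground D - u) = D"
    then show ?thesis using 1 2 3 v(2) by (simp add: 4 third_index_def max.commute)
  next
    assume "l (vert D u) = (ground D - u, u)" "l (vert D v) = (ground D - v, v)"
      "card u = D" "card (ground D - u) = D" "card v = D" "card (ground D - v) = D"
    then show ?thesis using 1 2 3 by (simp add: 4 third_index_def max.commute)
  qed
qed

text \<open>Representatives can be chosen so that the third index is the actual size of their
  intersection, with no maximum left. This turns statements about triples into plain set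
  theory.\<close>

lemma triple_obtain:
  assumes "x \<in> verts D" "y \<in> verts D" "triple D l x y = (i, j, t)"
  obtains u v where "u \<subseteq> ground D" "v \<subseteq> ground D" "x = vert D u" "y = vert D v"
    "card u = i" "card v = j" "card (u \<inter> v) = t" "i \<le> D" "j \<le> D" "t \<le> i" "t \<le> j"
    "third_index D i j t = t"
proof -
  obtain u v where u: "u \<subseteq> ground D" "card u \<le> D" "x = vert D u"
    and v: "v \<subseteq> ground D" "card v \<le> D" "y = vert D v"
    using assms(1,2) by (metis verts_obtain)
  have ij: "card u = i" "card v = j" "third_index D i j (card (u \<inter> v)) = t"
    using triple_vert[OF u(1,2) v(1,2)] assms(3) u v by auto
  have t: "(i, j, t) \<in> index_set D"
    using third_index_index_set[OF D_ge_3, of i j "card (u \<inter> v)"] u v ij card_Int_bound by auto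
  note rest = third_index_id[OF t]
  have bounds: "t \<le> i" "t \<le> j" using t by (auto simp: index_set_def)
  \<comment> \<open>If the maximum is attained at the other candidate, one of the vertices has level
    \<open>D\<close>; its representative is replaced by the complement, which has the same size and
    gives the same vertex.\<close>
  consider "card (u \<inter> v) = t" | "i = D" "j - card (u \<inter> v) = t" | "j = D" "i - card (u \<inter> v) = t"
    using ij u(2) v(2) by (auto simp: third_index_def max_def split: if_splits)
  then show thesis
  proof cases
    case 1
    then show ?thesis using that u v ij rest bounds by auto
  next
    case 2
    have "card ((ground D - u) \<inter> v) = t"
      using 2 card_Int_compl[OF v(1), of u] ij by (simp add: Int_commute)
    then show ?thesis
      using that[of "ground D - u" v] u v ij 2 rest bounds vert_compl card_compl_ground by auto
  next
    case 3
    have "card (u \<inter> (ground D - v)) = t"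
      using 3 card_Int_compl[OF u(1), of v] ij by simp
    then show ?thesis
      using that[of u "ground D - v"] u v ij 3 rest bounds vert_compl card_compl_ground by auto
  qed
qed

lemma triple_in_index_set:
  assumes "x \<in> verts D" "y \<in> verts D"
  shows "triple D l x y \<in> index_set D"
proof -
  obtain i j t where t: "triple D l x y = (i, j, t)" by (metis prod_cases3)
  show ?thesis
    using triple_obtain[OF assms t] third_index_index_set[OF D_ge_3] t by metis
qed

lemma index_set_realised:
  assumes "c \<in> index_set D"
  obtains x y where "x \<in> verts D" "y \<in> verts D" "triple D l x y = c"
proof -
  obtain i j t where c: "c = (i, j, t)" by (metis prod_cases3)
  have ijt: "t \<le> i" "t \<le> j" "i \<le> D" "j \<le> D" using assms c by (auto simp: index_set_def)
  \<comment> \<open>Two sets overlapping in an initial segment of length \<open>t\<close>; the other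
    \<open>j - t\<close> elements of \<open>v\<close> follow directly after \<open>u\<close>. They
    fit into the ground set because \<open>i + j \<le> 2 * D\<close>.\<close>
  define u v where "u = {1..i}" and "v = {1..t} \<union> {i + 1..i + j - t}"
  have "card v = card {1..t} + card {i + 1..i + j - t}"
    unfolding v_def using ijt by (intro card_Un_disjoint) auto
  then have cards: "card u = i" "card v = j" using ijt by (auto simp: u_def)
  have "u \<inter> v = {1..t}" using ijt by (auto simp: u_def v_def)
  then have "card (u \<inter> v) = t" by simp
  moreover have sub: "u \<subseteq> ground D" "v \<subseteq> ground D"
    using ijt by (auto simp: u_def v_def ground_def)
  ultimately have "triple D l (vert D u) (vert D v) = c"
    using triple_vert[of u v] cards ijt third_index_id assms c by simp
  then show thesis using that sub vert_in_verts by blast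
qed

lemma triple_vact:
  assumes p: "bij_betw p (ground D) (ground D)" and xy: "x \<in> verts D" "y \<in> verts D"
  shows "triple D l (vact p x) (vact p y) = triple D l x y"
proof -
  obtain u v where u: "u \<subseteq> ground D" "card u \<le> D" "x = vert D u"
    and v: "v \<subseteq> ground D" "card v \<le> D" "y = vert D v"
    using xy by (metis verts_obtain)
  show ?thesis
    using u v p by (simp add: vact_vert triple_vert perm_image perm_Int)
qed

text \<open>Together with \<open>triple_vact\<close> this identifies the triples with the orbits of
  the symmetric group on pairs of vertices.\<close>

lemma triple_eq_imp_conjugate:
  assumes "x \<in> verts D" "y \<in> verts D" "x' \<in> verts D" "y' \<in> verts D"
    and "triple D l x y = triple D l x' y'"
  obtains p where "bij_betw p (ground D) (ground D)" "vact p x = x'" "vact p y = y'"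
proof -
  obtain i j t where t: "triple D l x y = (i, j, t)" by (metis prod_cases3)
  then have t': "triple D l x' y' = (i, j, t)" using assms by simp
  obtain u v where u: "u \<subseteq> ground D" "v \<subseteq> ground D" "x = vert D u" "y = vert D v"
    "card u = i" "card v = j" "card (u \<inter> v) = t"
    using triple_obtain[OF assms(1,2) t] by metis
  obtain u' v' where u': "u' \<subseteq> ground D" "v' \<subseteq> ground D" "x' = vert D u'" "y' = vert D v'"
    "card u' = i" "card v' = j" "card (u' \<inter> v') = t"
    using triple_obtain[OF assms(3,4) t'] by metis
  obtain p where p: "bij_betw p (ground D) (ground D)" "p ` u = u'" "p ` v = v'"
    using perm_exists[of u D v u' v'] u u' by metis
  then show thesis using that vact_vert[OF p(1)] u u' by metis
qed

lemma M_mat_invariant: "M_mat D l c \<in> invariant_mats D"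
  by (auto simp: invariant_mats_def vmats_def M_mat_def vact_in_verts triple_vact)

section \<open>Orbit matrices as a basis of the invariant matrices\<close>

lemma finite_index_set: "finite (index_set D)"
proof (rule finite_subset)
  show "index_set D \<subseteq> {..D} \<times> {..D} \<times> {..D}" by (auto simp: index_set_def)
qed simp

text \<open>An invariant matrix is constant on orbits, and its coefficient at \<open>c\<close> is
  its value there. The second conclusion allows coefficients to be read off from entries.\<close>

lemma invariant_mat_expansion:
  assumes "A \<in> invariant_mats D"
  obtains a where "A = (\<Sum>c\<in>index_set D. vmat_scale (a c) (M_mat D l c))"
    and "\<And>x y. x \<in> verts D \<Longrightarrow> y \<in> verts D \<Longrightarrow> a (triple D l x y) = A x y"
proof -
  have const: "A x y = A x' y'"
    if *: "x \<in> verts D" "y \<in> verts D" "x' \<in> verts D" "y' \<in> verts D"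
      "triple D l x y = triple D l x' y'" for x y x' y'
  proof -
    obtain p where "bij_betw p (ground D) (ground D)" "vact p x = x'" "vact p y = y'"
      using triple_eq_imp_conjugate[OF *] .
    then show ?thesis using assms *(1,2) by (auto simp: invariant_mats_def)
  qed
  \<comment> \<open>The choice is unambiguous by \<open>const\<close>. At triples that no pair
    realises the value is arbitrary, but these are outside the index set.\<close>
  define a where "a c = (SOME r. \<exists>x\<in>verts D. \<exists>y\<in>verts D. triple D l x y = c \<and> r = A x y)" for c
  have a: "a (triple D l x y) = A x y" if "x \<in> verts D" "y \<in> verts D" for x y
    unfolding a_def
  proof (rule someI2_ex)
    show "\<exists>r. \<exists>x'\<in>verts D. \<exists>y'\<in>verts D. triple D l x' y' = triple D l x y \<and> r = A x' y'"
      using that by blast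
  qed (use const that in blast)
  have sum_app: "(\<Sum>c\<in>C. f c) x y = (\<Sum>c\<in>C. f c x y)"
    for f :: "nat \<times> nat \<times> nat \<Rightarrow> vmat" and C x y
    by (induction C rule: infinite_finite_induct) auto
  have "A x y = (\<Sum>c\<in>index_set D. vmat_scale (a c) (M_mat D l c)) x y" for x y
  proof (cases "x \<in> verts D \<and> y \<in> verts D")
    case True
    have "(\<Sum>c\<in>index_set D. vmat_scale (a c) (M_mat D l c)) x y =
        (\<Sum>c\<in>index_set D. if triple D l x y = c then a c else 0)"
      unfolding sum_app using True by (intro sum.cong) (auto simp: vmat_scale_def M_mat_def)
    also have "\<dots> = A x y"
      using True a finite_index_set triple_in_index_set by simp
    finally show ?thesis by simp
  next
    case False
    then have "A x y = 0" using assms by (auto simp: invariant_mats_def vmats_def)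
    then show ?thesis using False by (auto simp: sum_app vmat_scale_def M_mat_def)
  qed
  then have "A = (\<Sum>c\<in>index_set D. vmat_scale (a c) (M_mat D l c))" by blast
  then show thesis using that a by blast
qed

lemma M_span_eq_invariant: "M_span D l = invariant_mats D"
proof
  show "M_span D l \<subseteq> invariant_mats D"
    unfolding M_span_def
    by (rule vmat.span_minimal) (auto simp: M_mat_invariant subspace_invariant_mats)
  show "invariant_mats D \<subseteq> M_span D l"
  proof
    fix A assume "A \<in> invariant_mats D"
    then obtain a where A: "A = (\<Sum>c\<in>index_set D. vmat_scale (a c) (M_mat D l c))"
      using invariant_mat_expansion by metis
    show "A \<in> M_span D l"
      unfolding A M_span_def
      by (intro vmat.span_sum vmat.span_scale vmat.span_base) auto
  qed
qed

text \<open>Independence of the image as a set would not exclude repetitions in the indexed family;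
  this does. The matrices have disjoint supports, and each support is nonempty because every index
  is realised.\<close>

lemma inj_on_M_mat: "inj_on (M_mat D l) (index_set D)"
proof
  fix c c' assume c: "c \<in> index_set D" "c' \<in> index_set D" "M_mat D l c = M_mat D l c'"
  obtain x y where xy: "x \<in> verts D" "y \<in> verts D" "triple D l x y = c"
    using index_set_realised[OF c(1)] .
  have "M_mat D l c x y = 1" using xy by (simp add: M_mat_def)
  then have "M_mat D l c' x y = 1" by (simp only: c(3))
  then show "c = c'" using xy by (auto simp: M_mat_def split: if_splits)
qed

lemma independent_M_mat: "vmat.independent (M_mat D l ` index_set D)"
proof
  assume "vmat.dependent (M_mat D l ` index_set D)"
  then obtain c where c: "c \<in> index_set D"
    and dep: "M_mat D l c \<in> vmat.span (M_mat D l ` index_set D - {M_mat D l c})"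
    unfolding vmat.dependent_def by blast
  obtain x y where xy: "x \<in> verts D" "y \<in> verts D" "triple D l x y = c"
    using index_set_realised[OF c] .
  \<comment> \<open>Taking the entry at a pair in the support of \<open>M_mat D l c\<close> is a
    linear functional that kills all the other matrices but not this one.\<close>
  have "vmat.span (M_mat D l ` index_set D - {M_mat D l c}) \<subseteq> {A. A x y = 0}"
  proof (rule vmat.span_minimal)
    show "M_mat D l ` index_set D - {M_mat D l c} \<subseteq> {A. A x y = 0}"
      using xy by (auto simp: M_mat_def)
    show "vmat.subspace {A. A x y = 0}"
      by (rule vmat.subspaceI) (auto simp: vmat_scale_def)
  qed
  then show False using dep xy by (auto simp: M_mat_def)
qed

section \<open>The basis matrices lie in the Terwilliger algebra\<close>

lemma M_mat_mult_eq:
  assumes "x \<in> verts D" "y \<in> verts D"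
  shows "vmat_mult D (M_mat D l a) (M_mat D l b) x y =
    of_nat (card {z \<in> verts D. triple D l x z = a \<and> triple D l z y = b})"
proof -
  have "vmat_mult D (M_mat D l a) (M_mat D l b) x y =
      (\<Sum>z\<in>verts D. if triple D l x z = a \<and> triple D l z y = b then 1 else 0)"
    unfolding vmat_mult_def using assms by (intro sum.cong) (auto simp: M_mat_def)
  then show ?thesis by (simp add: sum.If_cases Int_def)
qed

lemma triple_components:
  assumes "x \<in> verts D" "y \<in> verts D" "z \<in> verts D"
    and "triple D l x z = (i, k, s)" "triple D l z y = (k', j, r)"
  obtains t where "triple D l x y = (i, j, t)"
proof -
  have "fst (triple D l x y) = fst (triple D l x z)"
    "fst (snd (triple D l x y)) = fst (snd (triple D l z y))"
    by (auto simp: triple_def Let_def split: prod.splits)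
  then show thesis using assms that by (metis fst_conv snd_conv prod.collapse)
qed

text \<open>By \<open>lower\<close> and \<open>witness\<close>, the product of the two matrices is a positive multiple of \<open>M\<close> at
  \<open>(i, j, t)\<close> plus a combination of matrices with larger third index.\<close>

lemma M_mat_product_triangular:
  assumes T: "M_mat D l (i, k, s) \<in> terwilliger D" "M_mat D l (k, j, r) \<in> terwilliger D"
    and lower: "\<And>x y z t'. x \<in> verts D \<Longrightarrow> y \<in> verts D \<Longrightarrow> z \<in> verts D \<Longrightarrow>
      triple D l x z = (i, k, s) \<Longrightarrow> triple D l z y = (k, j, r) \<Longrightarrow>
      triple D l x y = (i, j, t') \<Longrightarrow> t \<le> t'"
    and witness: "\<And>x y. x \<in> verts D \<Longrightarrow> y \<in> verts D \<Longrightarrow> triple D l x y = (i, j, t) \<Longrightarrow>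
      \<exists>z\<in>verts D. triple D l x z = (i, k, s) \<and> triple D l z y = (k, j, r)"
    and larger: "\<And>t'. t < t' \<Longrightarrow> (i, j, t') \<in> index_set D \<Longrightarrow> M_mat D l (i, j, t') \<in> terwilliger D"
    and c: "(i, j, t) \<in> index_set D"
  shows "M_mat D l (i, j, t) \<in> terwilliger D"
proof -
  let ?c = "(i, j, t)" and ?P = "vmat_mult D (M_mat D l (i, k, s)) (M_mat D l (k, j, r))"
  have PT: "?P \<in> terwilliger D" using T by (rule terwilliger_mult)
  obtain a where P: "?P = (\<Sum>d\<in>index_set D. vmat_scale (a d) (M_mat D l d))"
    and a: "\<And>x y. x \<in> verts D \<Longrightarrow> y \<in> verts D \<Longrightarrow> a (triple D l x y) = ?P x y"
    using invariant_mat_expansion[OF subsetD[OF terwilliger_subset_invariant PT]] by blast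
  \<comment> \<open>Entries of the product count middle vertices, so nothing can cancel: one witness
    makes the coefficient nonzero, and conversely a nonzero coefficient yields a middle
    vertex.\<close>
  have ac: "a ?c \<noteq> 0"
  proof -
    obtain x y where xy: "x \<in> verts D" "y \<in> verts D" "triple D l x y = ?c"
      using index_set_realised[OF c] .
    then have "{z \<in> verts D. triple D l x z = (i, k, s) \<and> triple D l z y = (k, j, r)} \<noteq> {}"
      using witness by blast
    then show ?thesis using a[OF xy(1,2)] xy M_mat_mult_eq[OF xy(1,2)] by simp
  qed
  \<comment> \<open>Each term with a nonzero coefficient has an index \<open>(i, j, t')\<close> with
    \<open>t < t'\<close>, so \<open>larger\<close> applies. Subtracting \<open>?R\<close> from the
    product and dividing by \<open>a ?c\<close> isolates the desired matrix.\<close>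
  let ?R = "\<Sum>d\<in>index_set D - {?c}. vmat_scale (a d) (M_mat D l d)"
  have "vmat_scale (a d) (M_mat D l d) \<in> terwilliger D" if d: "d \<in> index_set D - {?c}" for d
  proof (cases "a d = 0")
    case True
    then show ?thesis using vmat.subspace_0[OF subspace_terwilliger] by simp
  next
    case False
    obtain x y where xy: "x \<in> verts D" "y \<in> verts D" "triple D l x y = d"
      using index_set_realised[of d] d by blast
    have "{z \<in> verts D. triple D l x z = (i, k, s) \<and> triple D l z y = (k, j, r)} \<noteq> {}"
      using False a[OF xy(1,2)] xy M_mat_mult_eq[OF xy(1,2)] by force
    then obtain z where z: "z \<in> verts D" "triple D l x z = (i, k, s)" "triple D l z y = (k, j, r)"
      by blast
    then obtain t' where t': "d = (i, j, t')" using triple_components xy by metis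
    then have "t \<le> t'" using lower xy z by blast
    then have "M_mat D l d \<in> terwilliger D" using larger t' d by auto
    then show ?thesis by (rule vmat.subspace_scale[OF subspace_terwilliger])
  qed
  then have "?R \<in> terwilliger D" by (rule vmat.subspace_sum[OF subspace_terwilliger])
  with PT have "?P - ?R \<in> terwilliger D" by (rule vmat.subspace_diff[OF subspace_terwilliger])
  moreover have "?P = vmat_scale (a ?c) (M_mat D l ?c) + ?R"
    using P sum.remove[OF finite_index_set c] by (rule trans)
  ultimately have "vmat_scale (a ?c) (M_mat D l ?c) \<in> terwilliger D"
    by (simp only: add_diff_cancel_right')
  then have "vmat_scale (inverse (a ?c)) (vmat_scale (a ?c) (M_mat D l ?c)) \<in> terwilliger D"
    by (rule vmat.subspace_scale[OF subspace_terwilliger])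
  then show ?thesis using ac by (simp add: vmat.scale_scale)
qed

section \<open>Basis matrices obtained by cutting the generators into levels\<close>

lemma M_mat_diag_in_terwilliger:
  assumes "j \<le> D"
  shows "M_mat D l (j, j, j) \<in> terwilliger D"
proof -
  have "triple D l x y = (j, j, j) \<longleftrightarrow> x = y \<and> fdist (base D) y = j"
    if xy: "x \<in> verts D" "y \<in> verts D" for x y
  proof
    assume "triple D l x y = (j, j, j)"
    then obtain u v where u: "u \<subseteq> ground D" "v \<subseteq> ground D" "x = vert D u" "y = vert D v"
      "card u = j" "card v = j" "card (u \<inter> v) = j"
      using triple_obtain[OF xy] by metis
    \<comment> \<open>Representatives of size \<open>j\<close> that meet in \<open>j\<close>
      elements coincide, also at level \<open>D\<close>. Hence the matrix at
      \<open>(j, j, j)\<close> is a dual idempotent.\<close>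
    then have "u \<subseteq> v" "v \<subseteq> u"
      using card_Int_eqD[of u v D] card_Int_eqD[of v u D] by (auto simp: Int_commute)
    then have "u = v" by simp
    then show "x = y \<and> fdist (base D) y = j" using u fdist_base_vert assms by simp
  next
    assume *: "x = y \<and> fdist (base D) y = j"
    obtain u where u: "u \<subseteq> ground D" "card u \<le> D" "x = vert D u"
      using xy verts_obtain by metis
    then have "card u = j" using * fdist_base_vert by simp
    then show "triple D l x y = (j, j, j)"
      using * u triple_vert[of u u] by (auto simp: third_index_def)
  qed
  then have "M_mat D l (j, j, j) = dual_idem D j"
    by (auto simp: M_mat_def dual_idem_def fun_eq_iff)
  then show ?thesis using terwilliger_generators assms by simp
qed

text \<open>Dual idempotents are diagonal: on the left they select the rows, on the right the
  columns, of one level.\<close>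

lemma dual_dist_dual:
  "vmat_mult D (dual_idem D i) (vmat_mult D (dist_mat D k) (dual_idem D j)) x y =
    (if x \<in> verts D \<and> y \<in> verts D \<and> fdist (base D) x = i \<and> fdist x y = k \<and> fdist (base D) y = j
     then 1 else 0)"
proof -
  have 1: "vmat_mult D (dist_mat D k) (dual_idem D j) z y =
      (if y \<in> verts D \<and> fdist (base D) y = j then dist_mat D k z y else 0)" for z
  proof -
    have "vmat_mult D (dist_mat D k) (dual_idem D j) z y =
        (\<Sum>w\<in>verts D. if w = y then if fdist (base D) y = j then dist_mat D k z y else 0 else 0)"
      unfolding vmat_mult_def by (intro sum.cong) (auto simp: dual_idem_def)
    then show ?thesis by simp
  qed
  have "vmat_mult D (dual_idem D i) B x y =
      (if x \<in> verts D \<and> fdist (base D) x = i then B x y else 0)" for B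
  proof -
    have "vmat_mult D (dual_idem D i) B x y =
        (\<Sum>w\<in>verts D. if w = x then if fdist (base D) x = i then B x y else 0 else 0)"
      unfolding vmat_mult_def by (intro sum.cong) (auto simp: dual_idem_def)
    then show ?thesis by simp
  qed
  then show ?thesis by (simp only: 1) (simp add: dist_mat_def)
qed

lemma M_mat_step_in_terwilliger:
  assumes "i < D"
  shows "M_mat D l (i, Suc i, i) \<in> terwilliger D" "M_mat D l (Suc i, i, i) \<in> terwilliger D"
proof -
  have step: "M_mat D l (a, b, i) =
      vmat_mult D (dual_idem D a) (vmat_mult D (dist_mat D 1) (dual_idem D b))"
    if ab: "a = i \<and> b = Suc i \<or> a = Suc i \<and> b = i" for a b
  proof -
    have "triple D l x y = (a, b, i) \<longleftrightarrow>
        fdist (base D) x = a \<and> fdist x y = 1 \<and> fdist (base D) y = b"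
      if xy: "x \<in> verts D" "y \<in> verts D" for x y
    proof -
      obtain u v where u: "u \<subseteq> ground D" "card u \<le> D" "x = vert D u"
        and v: "v \<subseteq> ground D" "card v \<le> D" "y = vert D v"
        using xy by (metis verts_obtain)
      define s where "s = card (u \<inter> v)"
      have s: "s \<le> card u" "s \<le> card v" using card_Int_bound u v by (auto simp: s_def)
      \<comment> \<open>Next to level \<open>D\<close> both sides fold alike: \<open>s = 0\<close>
        also gives third index \<open>i\<close>, and the symmetric difference of size
        \<open>2 * D - 1\<close> has folded distance 1.\<close>
      have "third_index D a b s = i \<longleftrightarrow> min (a + b - 2 * s) (2 * D - (a + b - 2 * s)) = 1"
        if "s \<le> a" "s \<le> b"
        using that ab assms D_ge_3 by (auto simp: third_index_def max_def min_def)
      then show ?thesis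
        using u v s by (auto simp: triple_vert fdist_base_vert fdist_vert simp flip: s_def)
    qed
    then show ?thesis by (auto simp: fun_eq_iff dual_dist_dual M_mat_def)
  qed
  show "M_mat D l (i, Suc i, i) \<in> terwilliger D" "M_mat D l (Suc i, i, i) \<in> terwilliger D"
    using step[of i "Suc i"] step[of "Suc i" i] assms D_ge_3
    by (auto intro!: terwilliger_mult terwilliger_generators)
qed

text \<open>Containment of an \<open>i\<close>-set in a set of size \<open>j + 1\<close> factors
  through a set of size \<open>j\<close>, so the matrix is built up one level at a time.\<close>

lemma M_mat_containment_in_terwilliger:
  assumes "i \<le> j" "j \<le> D"
  shows "M_mat D l (i, j, i) \<in> terwilliger D \<and> M_mat D l (j, i, i) \<in> terwilliger D"
  using assms
proof (induction j rule: dec_induct)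
  case base
  then show ?case using M_mat_diag_in_terwilliger by simp
next
  case (step j)
  then have j: "i \<le> j" "j < D" "i < D" by auto
  have idx: "(i, Suc j, i) \<in> index_set D" "(Suc j, i, i) \<in> index_set D"
    using j D_ge_3 by (auto simp: index_set_def)
  \<comment> \<open>The third index never exceeds \<open>i\<close>, so the triangular product has no
    terms of larger index here.\<close>
  have no_larger: "(i, Suc j, t') \<notin> index_set D" "(Suc j, i, t') \<notin> index_set D" if "i < t'" for t'
    using that by (auto simp: index_set_def)
  have between: "\<exists>z. u \<subseteq> z \<and> z \<subseteq> w \<and> card z = j"
    if "u \<subseteq> w" "w \<subseteq> ground D" "card u = i" "card w = Suc j" for u w
  proof -
    have "u \<subset> w" using that j by auto
    then obtain e where "e \<in> w" "e \<notin> u" by blast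
    then show ?thesis using that by (intro exI[of _ "w - {e}"]) auto
  qed
  have chain: "triple D l (vert D u) (vert D z) = (i, j, i) \<and>
      triple D l (vert D z) (vert D w) = (j, Suc j, j) \<and>
      triple D l (vert D z) (vert D u) = (j, i, i) \<and>
      triple D l (vert D w) (vert D z) = (Suc j, j, j)"
    if "u \<subseteq> z" "z \<subseteq> w" "w \<subseteq> ground D" "card u = i" "card z = j" "card w = Suc j" for u z w
  proof -
    have "u \<inter> z = u" "z \<inter> u = u" "z \<inter> w = z" "w \<inter> z = z" "z \<subseteq> ground D" "u \<subseteq> ground D"
      using that by auto
    then show ?thesis using that j by (auto simp: triple_vert third_index_def)
  qed
  have "M_mat D l (i, Suc j, i) \<in> terwilliger D"
  proof (rule M_mat_product_triangular[OF _ M_mat_step_in_terwilliger(1)])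
    show "M_mat D l (i, j, i) \<in> terwilliger D" using step by simp
  next
    fix x y z t'
    assume *: "x \<in> verts D" "y \<in> verts D" "z \<in> verts D" "triple D l x z = (i, j, i)"
      "triple D l z y = (j, Suc j, j)" "triple D l x y = (i, Suc j, t')"
    obtain u z0 where u: "u \<subseteq> ground D" "z0 \<subseteq> ground D" "x = vert D u" "z = vert D z0"
      "card u = i" "card z0 = j" "card (u \<inter> z0) = i"
      using triple_obtain[OF *(1,3,4)] by metis
    obtain z1 w where w: "z1 \<subseteq> ground D" "w \<subseteq> ground D" "z = vert D z1" "y = vert D w"
      "card z1 = j" "card w = Suc j" "card (z1 \<inter> w) = j"
      using triple_obtain[OF *(3,2,5)] by metis
    \<comment> \<open>The middle vertex was represented once for each factor. Its level
      \<open>j\<close> is below \<open>D\<close>, so both representatives agree and the inclusions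
      can be chained.\<close>
    have "z0 = z1" using vert_eqD[of D z0 z1] u w j by simp
    then have "u \<subseteq> w" using card_Int_eqD[of u z0 D] card_Int_eqD[of z1 w D] u w by auto
    then have "card (u \<inter> w) = i" using u by (simp add: Int_absorb2)
    then show "i \<le> t'"
      using *(6) u w j triple_vert[of u w] by (auto simp: third_index_def)
  next
    fix x y assume *: "x \<in> verts D" "y \<in> verts D" "triple D l x y = (i, Suc j, i)"
    obtain u w where u: "u \<subseteq> ground D" "w \<subseteq> ground D" "x = vert D u" "y = vert D w"
      "card u = i" "card w = Suc j" "card (u \<inter> w) = i"
      using triple_obtain[OF *] by metis
    then have "u \<subseteq> w" using card_Int_eqD[of u w D] by simp
    then obtain z where z: "u \<subseteq> z" "z \<subseteq> w" "card z = j" using between u by blast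
    then have "vert D z \<in> verts D" using u by (intro vert_in_verts) auto
    then show "\<exists>z\<in>verts D. triple D l x z = (i, j, i) \<and> triple D l z y = (j, Suc j, j)"
      using chain[OF z(1,2) u(2,5) z(3) u(6)] u(3,4) by blast
  qed (use j idx no_larger in auto)
  moreover have "M_mat D l (Suc j, i, i) \<in> terwilliger D"
  proof (rule M_mat_product_triangular[OF M_mat_step_in_terwilliger(2)])
    show "M_mat D l (j, i, i) \<in> terwilliger D" using step by simp
  next
    fix y x z t'
    assume *: "y \<in> verts D" "x \<in> verts D" "z \<in> verts D" "triple D l y z = (Suc j, j, j)"
      "triple D l z x = (j, i, i)" "triple D l y x = (Suc j, i, t')"
    obtain z0 u where u: "u \<subseteq> ground D" "z0 \<subseteq> ground D" "x = vert D u" "z = vert D z0"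
      "card u = i" "card z0 = j" "card (z0 \<inter> u) = i"
      using triple_obtain[OF *(3,2,5)] by metis
    obtain w z1 where w: "z1 \<subseteq> ground D" "w \<subseteq> ground D" "z = vert D z1" "y = vert D w"
      "card z1 = j" "card w = Suc j" "card (w \<inter> z1) = j"
      using triple_obtain[OF *(1,3,4)] by metis
    have "z0 = z1" using vert_eqD[of D z0 z1] u w j by simp
    then have "u \<subseteq> w"
      using card_Int_eqD[of u z0 D] card_Int_eqD[of z1 w D] u w by (auto simp: Int_commute)
    then have "card (w \<inter> u) = i" using u by (simp add: Int_absorb1)
    then show "i \<le> t'"
      using *(6) u w j triple_vert[of w u] by (auto simp: third_index_def)
  next
    fix y x assume *: "y \<in> verts D" "x \<in> verts D" "triple D l y x = (Suc j, i, i)"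
    obtain w u where u: "u \<subseteq> ground D" "w \<subseteq> ground D" "x = vert D u" "y = vert D w"
      "card u = i" "card w = Suc j" "card (w \<inter> u) = i"
      using triple_obtain[OF *] by metis
    then have "u \<subseteq> w" using card_Int_eqD[of u w D] by (simp add: Int_commute)
    then obtain z where z: "u \<subseteq> z" "z \<subseteq> w" "card z = j" using between u by blast
    then have "vert D z \<in> verts D" using u by (intro vert_in_verts) auto
    then show "\<exists>z\<in>verts D. triple D l y z = (Suc j, j, j) \<and> triple D l z x = (j, i, i)"
      using chain[OF z(1,2) u(2,5) z(3) u(6)] u(3,4) by blast
  qed (use j idx no_larger in auto)
  ultimately show ?case by simp
qed

text \<open>Going down to a \<open>j\<close>-subset and up again reaches exactly the sets sharing at
  least \<open>j\<close> elements, up to complements at level \<open>D\<close>; the only larger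
  index is diagonal.\<close>

lemma M_mat_adjacent_in_terwilliger:
  assumes "j < D"
  shows "M_mat D l (Suc j, Suc j, j) \<in> terwilliger D"
proof (rule M_mat_product_triangular[OF M_mat_step_in_terwilliger(2)[OF assms]
      M_mat_step_in_terwilliger(1)[OF assms]])
  fix x y z t'
  assume *: "x \<in> verts D" "y \<in> verts D" "z \<in> verts D" "triple D l x z = (Suc j, j, j)"
    "triple D l z y = (j, Suc j, j)" "triple D l x y = (Suc j, Suc j, t')"
  obtain u z0 where u: "u \<subseteq> ground D" "z0 \<subseteq> ground D" "x = vert D u" "z = vert D z0"
    "card u = Suc j" "card z0 = j" "card (u \<inter> z0) = j"
    using triple_obtain[OF *(1,3,4)] by metis
  obtain z1 w where w: "z1 \<subseteq> ground D" "w \<subseteq> ground D" "z = vert D z1" "y = vert D w"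
    "card z1 = j" "card w = Suc j" "card (z1 \<inter> w) = j"
    using triple_obtain[OF *(3,2,5)] by metis
  have "z0 = z1" using vert_eqD[of D z0 z1] u w assms by simp
  then have "z0 \<subseteq> u \<inter> w"
    using card_Int_eqD[of z0 u D] card_Int_eqD[of z1 w D] u w by (auto simp: Int_commute)
  then have "j \<le> card (u \<inter> w)"
    using u card_mono[of "u \<inter> w" z0] finite_subset[OF _ finite_ground] by blast
  then show "j \<le> t'"
    using *(6) u w assms triple_vert[of u w] by (auto simp: third_index_def)
next
  fix x y assume *: "x \<in> verts D" "y \<in> verts D" "triple D l x y = (Suc j, Suc j, j)"
  obtain u w where u: "u \<subseteq> ground D" "w \<subseteq> ground D" "x = vert D u" "y = vert D w"
    "card u = Suc j" "card w = Suc j" "card (u \<inter> w) = j"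
    using triple_obtain[OF *] by metis
  \<comment> \<open>The middle vertex is given by the intersection, which has exactly
    \<open>j\<close> elements.\<close>
  have "u \<inter> (u \<inter> w) = u \<inter> w" "(u \<inter> w) \<inter> w = u \<inter> w" "u \<inter> w \<subseteq> ground D" using u by auto
  then show "\<exists>z\<in>verts D. triple D l x z = (Suc j, j, j) \<and> triple D l z y = (j, Suc j, j)"
    using u assms vert_in_verts[of "u \<inter> w" D]
    by (intro bexI[of _ "vert D (u \<inter> w)"]) (auto simp: triple_vert third_index_def)
next
  fix t' assume "j < t'" "(Suc j, Suc j, t') \<in> index_set D"
  then have "t' = Suc j" by (auto simp: index_set_def)
  then show "M_mat D l (Suc j, Suc j, t') \<in> terwilliger D"
    using M_mat_diag_in_terwilliger assms by simp
next
  \<comment> \<open>For \<open>Suc j = D\<close> this requires \<open>D + 1 \<le> 2 * D - 2\<close>,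
    hence \<open>D \<ge> 3\<close>.\<close>
  show "(Suc j, Suc j, j) \<in> index_set D"
    using assms D_ge_3 by (auto simp: index_set_def)
qed

text \<open>Downward induction on \<open>t\<close>, starting from containment at
  \<open>t = min i j\<close>. Exchanging one element of the second set changes the third index by at
  most one, so multiplying the matrix at \<open>t + 1\<close> by the adjacency matrix of level
  \<open>j\<close> reaches \<open>t\<close> and nothing lower.\<close>

lemma M_mat_in_terwilliger:
  assumes "(i, j, t) \<in> index_set D"
  shows "M_mat D l (i, j, t) \<in> terwilliger D"
  using assms
proof (induction "min i j - t" arbitrary: t rule: less_induct)
  case less
  then have bounds: "t \<le> i" "t \<le> j" "i \<le> D" "j \<le> D" by (auto simp: index_set_def)
  show ?case
  proof (cases "t = min i j")
    case True
    then show ?thesis using M_mat_containment_in_terwilliger bounds by (cases "i \<le> j") auto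
  next
    case False
    then have t: "t < i" "t < j" using bounds by auto
    then obtain k where k: "j = Suc k" by (cases j) auto
    have IH: "M_mat D l (i, j, t') \<in> terwilliger D" if "t < t'" "(i, j, t') \<in> index_set D" for t'
      using less.hyps[of t'] that t by auto
    have idx: "(i, j, Suc t) \<in> index_set D" using less.prems t by (auto simp: index_set_def)
    have idx': "(j, j, k) \<in> index_set D" using k bounds D_ge_3 by (auto simp: index_set_def)
    show ?thesis
    proof (rule M_mat_product_triangular[where k = j and s = "Suc t" and r = k])
      show "M_mat D l (i, j, Suc t) \<in> terwilliger D" using IH idx by simp
      show "M_mat D l (j, j, k) \<in> terwilliger D"
        using M_mat_adjacent_in_terwilliger k bounds by simp
    next
      fix x y z t'
      assume *: "x \<in> verts D" "y \<in> verts D" "z \<in> verts D" "triple D l x z = (i, j, Suc t)"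
        "triple D l z y = (j, j, k)" "triple D l x y = (i, j, t')"
      \<comment> \<open>The representatives \<open>v\<close> and \<open>w\<close> are fitted to the
        second factor, so \<open>card (u \<inter> v)\<close> need not be \<open>Suc t\<close>; only
        its \<open>third_index\<close> is. This is why \<open>third_index_lipschitz\<close> is
        needed for the comparison.\<close>
      obtain u where u: "u \<subseteq> ground D" "card u \<le> D" "x = vert D u"
        using *(1) verts_obtain by metis
      obtain v w where v: "v \<subseteq> ground D" "w \<subseteq> ground D" "z = vert D v" "y = vert D w"
        "card v = j" "card w = j" "card (v \<inter> w) = k"
        using triple_obtain[OF *(3,2,5)] by metis
      have fin: "finite u" "finite v" "finite w" using u v finite_subset[OF _ finite_ground] by blast+
      have diff: "card (v - w) = 1" "card (w - v) = 1"
        using fin v k by (auto simp: card_Diff_subset_Int Int_commute)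
      have "card (u \<inter> a) \<le> card (u \<inter> b) + 1" if "card (a - b) = 1" "finite a" "finite b" for a b
      proof -
        have "card (u \<inter> a) \<le> card ((u \<inter> b) \<union> (a - b))"
          using that fin by (intro card_mono) auto
        then show ?thesis using card_Un_le[of "u \<inter> b" "a - b"] that by simp
      qed
      then have "third_index D i j (card (u \<inter> v)) \<le> third_index D i j (card (u \<inter> w)) + 1"
        using diff fin by (intro third_index_lipschitz) auto
      then show "t \<le> t'"
        using *(4,6) u v bounds triple_vert[of u v] triple_vert[of u w] by auto
    next
      fix x y assume *: "x \<in> verts D" "y \<in> verts D" "triple D l x y = (i, j, t)"
      obtain u w where u: "u \<subseteq> ground D" "w \<subseteq> ground D" "x = vert D u" "y = vert D w"
        "card u = i" "card w = j" "card (u \<inter> w) = t"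
        using triple_obtain[OF *] by metis
      have fin: "finite u" "finite w" using u finite_subset[OF _ finite_ground] by blast+
      have "\<not> u \<subseteq> w" "\<not> w \<subseteq> u" using u t by (auto simp: Int_absorb1 Int_absorb2)
      then obtain e f where ef: "e \<in> u" "e \<notin> w" "f \<in> w" "f \<notin> u" by blast
      \<comment> \<open>Exchanging an element of \<open>w\<close> outside \<open>u\<close> for an
        element of \<open>u\<close> outside \<open>w\<close> raises the intersection with
        \<open>u\<close> from \<open>t\<close> to \<open>t + 1\<close> and leaves
        \<open>j - 1\<close> elements in common with \<open>w\<close>.\<close>
      define v where "v = insert e (w - {f})"
      have "card v = j" using ef fin u t by (simp add: v_def)
      moreover have "u \<inter> v = insert e (u \<inter> w)" using ef by (auto simp: v_def)
      then have "card (u \<inter> v) = Suc t" using ef fin u by simp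
      moreover have "v \<inter> w = w - {f}" using ef by (auto simp: v_def)
      then have "card (v \<inter> w) = k" using ef fin u k by simp
      moreover have "v \<subseteq> ground D" using u ef by (auto simp: v_def)
      ultimately show "\<exists>z\<in>verts D. triple D l x z = (i, j, Suc t) \<and> triple D l z y = (j, j, k)"
        using u bounds vert_in_verts[of v D] third_index_id[OF idx] third_index_id[OF idx']
        by (intro bexI[of _ "vert D v"]) (auto simp: triple_vert)
    qed (use IH less.prems in auto)
  qed
qed

lemma M_span_subset_terwilliger: "M_span D l \<subseteq> terwilliger D"
  unfolding M_span_def
  by (rule vmat.span_minimal) (auto simp: subspace_terwilliger M_mat_in_terwilliger)

end

theorem theorem3p8:
  fixes D :: nat and l :: "vertex \<Rightarrow> nat set \<times> nat set"
  assumes "D \<ge> 3" and "labelling D l"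
  shows "terwilliger D = M_span D l \<and>
    inj_on (M_mat D l) (index_set D) \<and>
    vmat.independent (M_mat D l ` index_set D) \<and>
    vmat.span (M_mat D l ` index_set D) = M_span D l"
proof -
  interpret folded_cube D l using assms by unfold_locales
  have "terwilliger D = M_span D l"
    using terwilliger_subset_invariant M_span_subset_terwilliger M_span_eq_invariant by blast
  then show ?thesis
    using inj_on_M_mat independent_M_mat by (simp add: M_span_def)
qed

end
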